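(* Let $B$ be a non-zero skew brace and let $A_1, A_2$ be subbraces of $B$ such that $B = A_1 + A_2 = A_1A_2$. (1) If $A_1$ and $A_2$ are trivial skew braces, then $\mathrm{Fix}(B)$ and $\ker\lambda$ are factorised subbraces of $B$ (with respect to $B = A_1 + A_2$). (2) If $A_1$ and $A_2$ are abelian skew braces, then $\mathrm{Soc}(B)$ and $Z(B)$ are factorised ideals of $B$ (with respect to $B=A_1+A_2$).
   Context: A (left) skew brace $(B,+,\cdot)$ is a set with two group structures $(B,+)$ and $(B,\cdot)$ (neither assumed abelian) such that $a(b+c) = ab - a + ac$ for all $a,b,c\in B$. Put $a * b = -a + ab - b$ and $\lambda_a(b) = -a + ab$; then $\lambda: a\mapsto\lambda_a$ is an action of $(B,\cdot)$ on $(B,+)$ by automorphisms. $X*Y$ denotes the subgroup of $(B,+)$ generated by $\{x*y : x\in X,y\in Y\}$; $X+Y$ and $XY$ are the element-wise sum and product sets. A subbrace of $B$ is a subset that is a subgroup of both $(B,+)$ and $(B,\cdot)$. A skew brace is trivial if $a*b=0$ for all $a,b$ (equivalently, the two operations coincide), and abelian if it is trivial and its additive group is abelian. A subbrace $L$ is a left ideal if $B*L\subseteq L$, a right ideal if $L*B\subseteq L$, and an ideal if it is both a left and a right ideal and $(L,+)$ is normal in $(B,+)$. Define $\ker\lambda=\{a\in B : \lambda_a(b)=b \text{ for all } b\in B\}$, $\mathrm{Fix}(B)=\{a\in B : \lambda_b(a)=a\text{ for all } b\in B\}$, $\mathrm{Soc}(B)=\ker\lambda\cap Z(B,+)$, and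 $Z(B)=\mathrm{Soc}(B)\cap Z(B,\cdot)$, where $Z(B,+)$ and $Z(B,\cdot)$ are the centres of the additive and multiplicative groups. A subbrace $S$ of a skew brace $B = A + C$ that is the sum of two subbraces $A$ and $C$ is called factorised if $S = (A\cap S)+(C\cap S)$ and $A\cap C\subseteq S$. *)

theory Defs
  imports "HOL-Algebra.AbelCoset" "HOL-Algebra.Generated_Groups"
begin

text \<open>
  A skew brace is carried by the record type of rings: \<open>\<oplus>\<close> and \<open>\<zero>\<close> are the additive
  operation and its neutral element, \<open>\<otimes>\<close> and \<open>\<one>\<close> the multiplicative ones.  Neither group is
  assumed commutative, so the library's ring locales do not apply, but the derived operations
  \<open>\<ominus>\<close>, \<open><+>\<close> and \<open><#>\<close> only depend on the record.
\<close>

locale skew_brace =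
  fixes B :: "('a, 'm) ring_scheme" (structure)
  assumes add_group: "group (add_monoid B)"
    and mult_group: "group B"
    and skew_distrib: "\<lbrakk>a \<in> carrier B; b \<in> carrier B; c \<in> carrier B\<rbrakk>
      \<Longrightarrow> a \<otimes> (b \<oplus> c) = ((a \<otimes> b) \<oplus> (\<ominus> a)) \<oplus> (a \<otimes> c)"

definition star :: "('a, 'm) ring_scheme \<Rightarrow> 'a \<Rightarrow> 'a \<Rightarrow> 'a" where
  "star B a b = ((\<ominus>\<^bsub>B\<^esub> a) \<oplus>\<^bsub>B\<^esub> (a \<otimes>\<^bsub>B\<^esub> b)) \<oplus>\<^bsub>B\<^esub> (\<ominus>\<^bsub>B\<^esub> b)"

definition lam :: "('a, 'm) ring_scheme \<Rightarrow> 'a \<Rightarrow> 'a \<Rightarrow> 'a" where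
  "lam B a b = (\<ominus>\<^bsub>B\<^esub> a) \<oplus>\<^bsub>B\<^esub> (a \<otimes>\<^bsub>B\<^esub> b)"

definition star_set :: "('a, 'm) ring_scheme \<Rightarrow> 'a set \<Rightarrow> 'a set \<Rightarrow> 'a set" where
  "star_set B X Y = generate (add_monoid B) {star B x y | x y. x \<in> X \<and> y \<in> Y}"

locale trivial_skew_brace = skew_brace +
  assumes star_zero: "\<lbrakk>a \<in> carrier B; b \<in> carrier B\<rbrakk> \<Longrightarrow> star B a b = \<zero>"

locale abelian_skew_brace = trivial_skew_brace +
  assumes add_comm_group: "comm_group (add_monoid B)"

definition subbrace :: "'a set \<Rightarrow> ('a, 'm) ring_scheme \<Rightarrow> bool" where
  "subbrace S B \<longleftrightarrow> subgroup S (add_monoid B) \<and> subgroup S B"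

text \<open>A subbrace \<open>S\<close> is regarded as a skew brace in its own right as \<open>B\<lparr>carrier := S\<rparr>\<close>.\<close>

lemma (in skew_brace) subbrace_imp_skew_brace:
  assumes "subbrace S B"
  shows "skew_brace (B\<lparr>carrier := S\<rparr>)"
proof -
  have a: "subgroup S (add_monoid B)" and m: "subgroup S B"
    using assms by (auto simp: subbrace_def)
  have sub: "S \<subseteq> carrier B"
    using subgroup.subset[OF m] .
  have inv: "\<ominus>\<^bsub>B\<lparr>carrier := S\<rparr>\<^esub> x = \<ominus> x" if "x \<in> S" for x
    using group.m_inv_consistent[OF add_group a that] by (simp add: a_inv_def)
  show ?thesis
  proof (rule skew_brace.intro)
    show "group (add_monoid (B\<lparr>carrier := S\<rparr>))"
      using group.subgroup_imp_group[OF add_group a] by simp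
    show "group (B\<lparr>carrier := S\<rparr>)"
      using group.subgroup_imp_group[OF mult_group m] .
  qed (simp_all add: inv skew_distrib subsetD[OF sub])
qed

definition left_ideal :: "'a set \<Rightarrow> ('a, 'm) ring_scheme \<Rightarrow> bool" where
  "left_ideal L B \<longleftrightarrow> subbrace L B \<and> star_set B (carrier B) L \<subseteq> L"

definition right_ideal :: "'a set \<Rightarrow> ('a, 'm) ring_scheme \<Rightarrow> bool" where
  "right_ideal L B \<longleftrightarrow> subbrace L B \<and> star_set B L (carrier B) \<subseteq> L"

definition brace_ideal :: "'a set \<Rightarrow> ('a, 'm) ring_scheme \<Rightarrow> bool" where
  "brace_ideal I B \<longleftrightarrow> left_ideal I B \<and> right_ideal I B \<and> I \<lhd> add_monoid B"

definition group_centre :: "('a, 'm) monoid_scheme \<Rightarrow> 'a set" where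
  "group_centre G = {a \<in> carrier G. \<forall>b \<in> carrier G. a \<otimes>\<^bsub>G\<^esub> b = b \<otimes>\<^bsub>G\<^esub> a}"

definition ker_lam :: "('a, 'm) ring_scheme \<Rightarrow> 'a set" where
  "ker_lam B = {a \<in> carrier B. \<forall>b \<in> carrier B. lam B a b = b}"

definition Fix :: "('a, 'm) ring_scheme \<Rightarrow> 'a set" where
  "Fix B = {a \<in> carrier B. \<forall>b \<in> carrier B. lam B b a = a}"

definition Soc :: "('a, 'm) ring_scheme \<Rightarrow> 'a set" where
  "Soc B = ker_lam B \<inter> group_centre (add_monoid B)"

definition brace_centre :: "('a, 'm) ring_scheme \<Rightarrow> 'a set" where
  "brace_centre B = Soc B \<inter> group_centre B"

definition factorised :: "'a set \<Rightarrow> 'a set \<Rightarrow> 'a set \<Rightarrow> ('a, 'm) ring_scheme \<Rightarrow> bool" where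
  "factorised S A C B \<longleftrightarrow>
     subbrace A B \<and> subbrace C B \<and> carrier B = A <+>\<^bsub>B\<^esub> C \<and>
     subbrace S B \<and> S = (A \<inter> S) <+>\<^bsub>B\<^esub> (C \<inter> S) \<and> A \<inter> C \<subseteq> S"

end

theory Submission
  imports Defs
begin

text \<open>
  Triviality of \<open>A\<close> and \<open>C\<close> means that \<open>\<lambda>\<close> of elements of \<open>A\<close> fixes \<open>A\<close> pointwise, and likewise
  for \<open>C\<close>.  If \<open>a + c \<in> Fix(B)\<close>, then applying \<open>\<lambda>\<close> of elements of \<open>C\<close> shows that they fix \<open>a\<close>,
  so \<open>a \<in> Fix(B)\<close> because \<open>B = AC\<close>.  If \<open>ac \<in> ker \<lambda>\<close>, then evaluating \<open>\<lambda>\<^sub>a \<circ> \<lambda>\<^sub>c\<close> on \<open>C\<close> shows that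
  \<open>\<lambda>\<^sub>a\<close> fixes \<open>C\<close>, so \<open>a \<in> ker \<lambda>\<close> because \<open>B = A + C\<close>, and then \<open>ac = a + c\<close>.
  In the abelian case, commuting such an element with elements of \<open>A\<close> shows that \<open>c\<close> is central,
  for either operation.
\<close>

section \<open>Centres of groups that are products of two subgroups\<close>

lemma (in group) group_centre_subgroup: "subgroup (group_centre G) G"
proof (rule subgroupI)
  have "\<one> \<in> group_centre G"
    by (simp add: group_centre_def)
  then show "group_centre G \<noteq> {}"
    by blast
next
  fix a assume a: "a \<in> group_centre G"
  then have ac: "a \<in> carrier G"
    by (simp add: group_centre_def)
  have "inv a \<otimes> b = b \<otimes> inv a" if "b \<in> carrier G" for b
  proof -
    have "a \<otimes> inv b = inv b \<otimes> a"
      using a that by (simp add: group_centre_def)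
    then have "inv (a \<otimes> inv b) = inv (inv b \<otimes> a)"
      by simp
    then show ?thesis
      using ac that by (simp add: inv_mult_group)
  qed
  then show "inv a \<in> group_centre G"
    using ac by (simp add: group_centre_def)
next
  fix a b assume ab: "a \<in> group_centre G" "b \<in> group_centre G"
  then have c: "a \<in> carrier G" "b \<in> carrier G"
    by (simp_all add: group_centre_def)
  have "a \<otimes> b \<otimes> x = x \<otimes> (a \<otimes> b)" if x: "x \<in> carrier G" for x
  proof -
    have comm: "a \<otimes> x = x \<otimes> a" "b \<otimes> x = x \<otimes> b"
      using ab x by (simp_all add: group_centre_def)
    have "a \<otimes> b \<otimes> x = a \<otimes> x \<otimes> b"
      using c x comm(2) by (simp add: m_assoc)
    also have "\<dots> = x \<otimes> (a \<otimes> b)"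
      unfolding comm(1) using c x by (simp add: m_assoc)
    finally show ?thesis .
  qed
  then show "a \<otimes> b \<in> group_centre G"
    using c by (simp add: group_centre_def)
qed (auto simp: group_centre_def)

lemma (in group) central_subgroup_normal:
  assumes "subgroup H G" "H \<subseteq> group_centre G"
  shows "H \<lhd> G"
proof (rule normal_invI)
  fix x h assume x: "x \<in> carrier G" and h: "h \<in> H"
  then have hc: "h \<in> carrier G" "x \<otimes> h = h \<otimes> x"
    using assms(2) by (auto simp: group_centre_def)
  have "x \<otimes> h \<otimes> inv x = h \<otimes> (x \<otimes> inv x)"
    unfolding hc(2) using x hc(1) by (simp add: m_assoc)
  then show "x \<otimes> h \<otimes> inv x \<in> H"
    using x h hc(1) by simp
qed (fact assms(1))

text \<open>The centralizer of \<open>x\<close> is closed under products, so it is everything once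
  it contains both factors.\<close>

lemma (in group) group_centreI_set_mult:
  assumes H: "subgroup H G" and K: "subgroup K G" and HK: "carrier G = H <#> K"
    and x: "x \<in> carrier G"
    and xH: "\<And>h. h \<in> H \<Longrightarrow> x \<otimes> h = h \<otimes> x" and xK: "\<And>k. k \<in> K \<Longrightarrow> x \<otimes> k = k \<otimes> x"
  shows "x \<in> group_centre G"
proof -
  have "x \<otimes> b = b \<otimes> x" if "b \<in> carrier G" for b
  proof -
    have "b \<in> H <#> K"
      using HK that by simp
    then obtain h k where hk: "h \<in> H" "k \<in> K" "b = h \<otimes> k"
      unfolding set_mult_def by blast
    have mem: "h \<in> carrier G" "k \<in> carrier G"
      using subgroup.mem_carrier[OF H hk(1)] subgroup.mem_carrier[OF K hk(2)] .
    have "x \<otimes> (h \<otimes> k) = h \<otimes> (x \<otimes> k)"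
      using mem x xH[OF hk(1)] by (simp flip: m_assoc)
    also have "\<dots> = (h \<otimes> k) \<otimes> x"
      using mem x xK[OF hk(2)] by (simp add: m_assoc)
    finally show ?thesis
      by (simp add: hk(3))
  qed
  with x show ?thesis
    by (simp add: group_centre_def)
qed

text \<open>For \<open>y\<close> in \<open>H\<close>, \<open>h\<close> commutes with
  \<open>y\<close>, so it can be cancelled from
  \<open>h \<otimes> k \<otimes> y = y \<otimes> (h \<otimes> k)\<close>; thus \<open>k\<close>
  centralizes \<open>H\<close> as well as \<open>K\<close>. Then \<open>h\<close> is a quotient of
  two central elements. The setting is an arbitrary group because both operations of a skew brace
  are instances.\<close>

lemma (in group) group_centre_factor:
  assumes H: "comm_group (G\<lparr>carrier := H\<rparr>)" "subgroup H G"
    and K: "comm_group (G\<lparr>carrier := K\<rparr>)" "subgroup K G"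
    and HK: "carrier G = H <#> K"
    and hk: "h \<in> H" "k \<in> K" "h \<otimes> k \<in> group_centre G"
  shows "h \<in> group_centre G" "k \<in> group_centre G"
proof -
  have Hc: "x \<otimes> y = y \<otimes> x" if "x \<in> H" "y \<in> H" for x y
    using comm_monoid.m_comm[OF comm_group.axioms(1)[OF H(1)]] that by simp
  have Kc: "x \<otimes> y = y \<otimes> x" if "x \<in> K" "y \<in> K" for x y
    using comm_monoid.m_comm[OF comm_group.axioms(1)[OF K(1)]] that by simp
  note mem = subgroup.mem_carrier[OF H(2)] subgroup.mem_carrier[OF K(2)]
  have kH: "k \<otimes> y = y \<otimes> k" if y: "y \<in> H" for y
  proof -
    have c: "h \<in> carrier G" "k \<in> carrier G" "y \<in> carrier G"
      using hk y mem by auto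
    have "h \<otimes> k \<otimes> y = y \<otimes> (h \<otimes> k)"
      using hk(3) c(3) unfolding group_centre_def by blast
    also have "\<dots> = h \<otimes> y \<otimes> k"
      unfolding Hc[OF hk(1) y] using c by (simp add: m_assoc)
    finally have "h \<otimes> (k \<otimes> y) = h \<otimes> (y \<otimes> k)"
      using c by (simp add: m_assoc)
    then show ?thesis
      using c by simp
  qed
  show k: "k \<in> group_centre G"
    using hk by (intro group_centreI_set_mult[OF H(2) K(2) HK mem(2) kH Kc])
  have "h \<otimes> k \<otimes> inv k = h"
    using hk mem by (simp add: m_assoc)
  then show "h \<in> group_centre G"
    using subgroup.m_closed[OF group_centre_subgroup hk(3)
        subgroup.m_inv_closed[OF group_centre_subgroup k]] by simp
qed

lemma (in group) Int_subset_group_centre: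
  assumes H: "comm_group (G\<lparr>carrier := H\<rparr>)" "subgroup H G"
    and K: "comm_group (G\<lparr>carrier := K\<rparr>)" "subgroup K G"
    and HK: "carrier G = H <#> K"
  shows "H \<inter> K \<subseteq> group_centre G"
proof
  fix x assume x: "x \<in> H \<inter> K"
  have Hc: "x \<otimes> y = y \<otimes> x" if "y \<in> H" for y
    using comm_monoid.m_comm[OF comm_group.axioms(1)[OF H(1)]] that x by simp
  have Kc: "x \<otimes> y = y \<otimes> x" if "y \<in> K" for y
    using comm_monoid.m_comm[OF comm_group.axioms(1)[OF K(1)]] that x by simp
  show "x \<in> group_centre G"
    using x subgroup.mem_carrier[OF H(2)]
    by (intro group_centreI_set_mult[OF H(2) K(2) HK _ Hc Kc]) auto
qed

section \<open>The two groups of a skew brace and the action lambda\<close>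

sublocale skew_brace \<subseteq> group B
  by (fact mult_group)

text \<open>The rewrites present the additive group in ring notation, so that facts with prefix
  \<open>add\<close> match terms built from \<open>\<oplus>\<close>, \<open>\<zero>\<close> and
  \<open>\<ominus>\<close>.\<close>

sublocale skew_brace \<subseteq> add: group "add_monoid B"
  rewrites "carrier (add_monoid B) = carrier B"
    and "mult (add_monoid B) = add B"
    and "one (add_monoid B) = zero B"
    and "m_inv (add_monoid B) = a_inv B"
    and "set_mult (add_monoid B) = set_add B"
  by (fact add_group) (simp_all add: a_inv_def set_add_def fun_eq_iff)

context skew_brace
begin

lemma lam_closed [simp]: "\<lbrakk>a \<in> carrier B; b \<in> carrier B\<rbrakk> \<Longrightarrow> lam B a b \<in> carrier B"
  by (simp add: lam_def)

lemma mult_eq_add_lam: "\<lbrakk>a \<in> carrier B; b \<in> carrier B\<rbrakk> \<Longrightarrow> a \<otimes> b = a \<oplus> lam B a b"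
  by (simp add: lam_def flip: add.m_assoc)

lemma lam_add:
  "\<lbrakk>a \<in> carrier B; b \<in> carrier B; c \<in> carrier B\<rbrakk> \<Longrightarrow> lam B a (b \<oplus> c) = lam B a b \<oplus> lam B a c"
  by (simp add: lam_def skew_distrib add.m_assoc)

text \<open>Expand both bracketings of \<open>a \<otimes> b \<otimes> c\<close> by
  \<open>mult_eq_add_lam\<close>; each becomes \<open>a \<otimes> b\<close> plus one side of the
  claim, and \<open>a \<otimes> b\<close> cancels in the additive group.\<close>

lemma lam_mult:
  assumes "a \<in> carrier B" "b \<in> carrier B" "c \<in> carrier B"
  shows "lam B (a \<otimes> b) c = lam B a (lam B b c)"
proof -
  have "(a \<otimes> b) \<oplus> lam B (a \<otimes> b) c = a \<otimes> (b \<otimes> c)"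
    using assms by (simp add: m_assoc flip: mult_eq_add_lam)
  also have "\<dots> = a \<oplus> (lam B a b \<oplus> lam B a (lam B b c))"
    using assms by (simp add: mult_eq_add_lam lam_add)
  also have "\<dots> = (a \<otimes> b) \<oplus> lam B a (lam B b c)"
    using assms by (simp add: mult_eq_add_lam add.m_assoc)
  finally show ?thesis
    using assms by simp
qed

lemma one_eq_zero: "\<one> = \<zero>"
proof -
  \<comment> \<open>The summand \<open>\<zero>\<close> is kept in place so that distributivity
    applies: it turns the right side into
    \<open>(\<zero> \<oplus> \<ominus> \<one>) \<oplus> \<one>\<close>, which is zero.\<close>
  have "\<zero> \<oplus> \<one> = \<one> \<otimes> (\<zero> \<oplus> \<one>)"
    by (simp del: add.l_one)
  also have "\<dots> = (\<zero> \<oplus> \<ominus> \<one>) \<oplus> \<one>"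
    by (subst skew_distrib) simp_all
  finally show ?thesis
    by (simp add: add.m_assoc)
qed

lemma lam_one [simp]: "b \<in> carrier B \<Longrightarrow> lam B \<one> b = b"
  by (simp add: lam_def one_eq_zero)

lemma lam_zero [simp]: "a \<in> carrier B \<Longrightarrow> lam B a \<zero> = \<zero>"
  by (simp add: lam_def flip: one_eq_zero)

lemma lam_minus: "\<lbrakk>a \<in> carrier B; b \<in> carrier B\<rbrakk> \<Longrightarrow> lam B a (\<ominus> b) = \<ominus> lam B a b"
  by (rule add.inv_equality[symmetric]) (simp_all flip: lam_add)

lemma lam_inv_lam [simp]:
  "\<lbrakk>a \<in> carrier B; b \<in> carrier B\<rbrakk> \<Longrightarrow> lam B (inv a) (lam B a b) = b"
  by (simp flip: lam_mult)

lemma lam_lam_inv [simp]: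
  "\<lbrakk>a \<in> carrier B; b \<in> carrier B\<rbrakk> \<Longrightarrow> lam B a (lam B (inv a) b) = b"
  by (simp flip: lam_mult)

lemma star_eq_lam_minus: "star B a b = lam B a b \<oplus> \<ominus> b"
  by (simp add: star_def lam_def)

lemma lam_inv_self: "a \<in> carrier B \<Longrightarrow> lam B a (inv a) = \<ominus> a"
  by (simp add: lam_def one_eq_zero)

section \<open>Subbraces: Fix, the kernel of lambda, the socle and the centre\<close>

lemma subbrace_subset: "subbrace S B \<Longrightarrow> S \<subseteq> carrier B"
  by (auto simp: subbrace_def dest: subgroup.subset)

lemma trivial_subbrace_lam:
  assumes S: "subbrace S B" and t: "trivial_skew_brace (B\<lparr>carrier := S\<rparr>)"
    and xy: "x \<in> S" "y \<in> S"
  shows "lam B x y = y"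
proof -
  have a: "subgroup S (add_monoid B)"
    using S by (simp add: subbrace_def)
  have inv: "\<ominus>\<^bsub>B\<lparr>carrier := S\<rparr>\<^esub> z = \<ominus> z" if "z \<in> S" for z
    using group.m_inv_consistent[OF add_group a that] by (simp add: a_inv_def)
  have mem: "x \<in> carrier B" "y \<in> carrier B"
    using subbrace_subset[OF S] xy by auto
  have "star B x y = \<zero>"
    using trivial_skew_brace.star_zero[OF t, of x y] xy by (simp add: star_def inv)
  then have "lam B x y \<oplus> \<ominus> y \<oplus> y = y"
    using mem by (simp add: star_eq_lam_minus)
  then show ?thesis
    using mem by (simp add: add.m_assoc)
qed

text \<open>On \<open>Fix(B)\<close> and on \<open>ker \<lambda>\<close> the two operations coincide, so subgroups of either kind agree.\<close>

lemma additive_subgroup_imp_subbrace: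
  assumes S: "subgroup S (add_monoid B)"
    and triv: "\<And>x y. \<lbrakk>x \<in> S; y \<in> S\<rbrakk> \<Longrightarrow> lam B x y = y"
  shows "subbrace S B"
proof -
  have sub: "x \<in> carrier B" if "x \<in> S" for x
    using subgroup.mem_carrier[OF S that] by simp
  have minus: "\<ominus> x \<in> S" if "x \<in> S" for x
    using subgroup.m_inv_closed[OF S that] by (simp add: a_inv_def)
  have "subgroup S B"
  proof (rule subgroupI)
    show "S \<noteq> {}"
      using subgroup.one_closed[OF S] by blast
    show "inv x \<in> S" if x: "x \<in> S" for x
    proof -
      \<comment> \<open>The map \<open>lam B x\<close> fixes \<open>\<ominus> x\<close>, so this
        product is the sum \<open>x \<oplus> \<ominus> x\<close>.\<close>
      have "x \<otimes> \<ominus> x = \<one>"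
        using x sub minus triv by (simp add: mult_eq_add_lam one_eq_zero)
      then have "inv x = \<ominus> x"
        using x sub by (metis add.inv_closed inv_equality inv_inv)
      then show ?thesis
        using minus[OF x] by simp
    qed
    show "x \<otimes> y \<in> S" if "x \<in> S" "y \<in> S" for x y
      using that subgroup.m_closed[OF S that] sub triv by (simp add: mult_eq_add_lam)
  qed (use sub in auto)
  with S show ?thesis
    by (simp add: subbrace_def)
qed

lemma Fix_subbrace: "subbrace (Fix B) B"
proof (rule additive_subgroup_imp_subbrace)
  show "subgroup (Fix B) (add_monoid B)"
  proof (rule group.subgroupI[OF add_group])
    have "\<zero> \<in> Fix B"
      by (simp add: Fix_def)
    then show "Fix B \<noteq> {}"
      by blast
  qed (auto simp: Fix_def lam_add lam_minus simp flip: a_inv_def)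
qed (auto simp: Fix_def)

text \<open>Closure is natural for the multiplication, since lambda is an action of the
  multiplicative group. It transfers to addition because \<open>a \<otimes> b = a \<oplus> b\<close>
  and \<open>inv a = \<ominus> a\<close> for \<open>a\<close> in the kernel.\<close>

lemma ker_lam_additive_subgroup: "subgroup (ker_lam B) (add_monoid B)"
proof (rule group.subgroupI[OF add_group])
  have "\<one> \<in> ker_lam B"
    by (simp add: ker_lam_def)
  then show "ker_lam B \<noteq> {}"
    by blast
next
  fix a assume a: "a \<in> ker_lam B"
  then have ac: "a \<in> carrier B"
    by (simp add: ker_lam_def)
  have "inv a \<in> ker_lam B"
    using a lam_inv_lam[OF ac] by (simp add: ker_lam_def)
  moreover have "inv a = \<ominus> a"
    using a lam_inv_self[OF ac] by (simp add: ker_lam_def)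
  ultimately show "inv\<^bsub>add_monoid B\<^esub> a \<in> ker_lam B"
    by (simp add: a_inv_def)
next
  fix a b assume ab: "a \<in> ker_lam B" "b \<in> ker_lam B"
  then have "a \<otimes> b \<in> ker_lam B"
    by (simp add: ker_lam_def lam_mult)
  moreover have "a \<otimes> b = a \<oplus> b"
    using ab by (simp add: ker_lam_def mult_eq_add_lam)
  ultimately show "a \<otimes>\<^bsub>add_monoid B\<^esub> b \<in> ker_lam B"
    by simp
qed (auto simp: ker_lam_def)

lemma additive_subgroup_ker_lam_subbrace:
  assumes "subgroup S (add_monoid B)" "S \<subseteq> ker_lam B"
  shows "subbrace S B"
proof (rule additive_subgroup_imp_subbrace[OF assms(1)])
  fix x y assume "x \<in> S" "y \<in> S"
  then have "x \<in> ker_lam B" "y \<in> ker_lam B"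
    using assms(2) by auto
  then show "lam B x y = y"
    by (simp add: ker_lam_def)
qed

lemma ker_lam_subbrace: "subbrace (ker_lam B) B"
  by (simp add: additive_subgroup_ker_lam_subbrace ker_lam_additive_subgroup)

lemma Soc_additive_subgroup: "subgroup (Soc B) (add_monoid B)"
  unfolding Soc_def
  by (rule group.subgroups_Inter_pair[OF add_group])
    (simp_all add: ker_lam_additive_subgroup group.group_centre_subgroup add_group)

lemma Soc_subbrace: "subbrace (Soc B) B"
  by (rule additive_subgroup_ker_lam_subbrace[OF Soc_additive_subgroup]) (simp add: Soc_def)

text \<open>As an intersection of multiplicative subgroups this is one itself; inside the socle sums
  and negatives are products and inverses, which gives the additive half.\<close>

lemma brace_centre_subbrace: "subbrace (brace_centre B) B"
proof -
  have m: "subgroup (brace_centre B) B"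
    unfolding brace_centre_def using Soc_subbrace
    by (intro subgroups_Inter_pair) (auto simp: subbrace_def group_centre_subgroup)
  have add_eq: "x \<otimes> y = x \<oplus> y" if "x \<in> Soc B" "y \<in> Soc B" for x y
    using that by (simp add: Soc_def ker_lam_def mult_eq_add_lam)
  have inv_eq: "inv x = \<ominus> x" if "x \<in> Soc B" for x
    using that lam_inv_self[of x] by (simp add: Soc_def ker_lam_def)
  have sub: "x \<in> Soc B" "x \<in> carrier B" if "x \<in> brace_centre B" for x
    using that by (auto simp: brace_centre_def group_centre_def)
  have "subgroup (brace_centre B) (add_monoid B)"
  proof (rule group.subgroupI[OF add_group])
    show "brace_centre B \<noteq> {}"
      using subgroup.one_closed[OF m] by blast
    show "inv\<^bsub>add_monoid B\<^esub> x \<in> brace_centre B" if "x \<in> brace_centre B" for x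
      using subgroup.m_inv_closed[OF m that] inv_eq[OF sub(1)[OF that]] by (simp add: a_inv_def)
    show "x \<otimes>\<^bsub>add_monoid B\<^esub> y \<in> brace_centre B"
      if "x \<in> brace_centre B" "y \<in> brace_centre B" for x y
      using subgroup.m_closed[OF m that] add_eq sub that by simp
  qed (use sub in auto)
  with m show ?thesis
    by (simp add: subbrace_def)
qed

section \<open>The socle and the centre as ideals\<close>

lemma lam_Soc_eq_conj:
  assumes b: "b \<in> carrier B" and s: "s \<in> Soc B"
  shows "lam B b s = b \<otimes> s \<otimes> inv b"
proof -
  have sc: "s \<in> carrier B"
    using s by (simp add: Soc_def ker_lam_def)
  have s_add: "s \<otimes> inv b = s \<oplus> inv b"
    using b s sc mult_eq_add_lam[of s "inv b"] by (simp add: Soc_def ker_lam_def)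
  \<comment> \<open>Apply the additive map \<open>lam B b\<close> to the commutation of
    \<open>s\<close> with \<open>d\<close>, the preimage of \<open>\<ominus> b\<close>.\<close>
  have "lam B b s \<oplus> \<ominus> b = \<ominus> b \<oplus> lam B b s"
  proof -
    define d where "d = lam B (inv b) (\<ominus> b)"
    have d: "d \<in> carrier B" "lam B b d = \<ominus> b"
      using b by (simp_all add: d_def)
    have "s \<oplus> d = d \<oplus> s"
      using s d by (simp add: Soc_def group_centre_def)
    then have "lam B b (s \<oplus> d) = lam B b (d \<oplus> s)"
      by simp
    then show ?thesis
      using b sc d by (simp add: lam_add)
  qed
  then have swap: "b \<oplus> (lam B b s \<oplus> \<ominus> b) = lam B b s"
    using b sc by (simp flip: add.m_assoc)
  have "b \<otimes> s \<otimes> inv b = b \<otimes> (s \<oplus> inv b)"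
    using b sc by (simp add: m_assoc s_add)
  also have "\<dots> = b \<oplus> (lam B b s \<oplus> \<ominus> b)"
    using b sc by (simp add: mult_eq_add_lam lam_add lam_inv_self)
  finally show ?thesis
    using swap by simp
qed

text \<open>By \<open>lam_Soc_eq_conj\<close> the element is a multiplicative conjugate of
  \<open>s\<close>, and the kernel of an action is normal. It is additively central because
  \<open>lam B b\<close> is an automorphism of the additive group.\<close>

lemma lam_Soc_closed:
  assumes b: "b \<in> carrier B" and s: "s \<in> Soc B"
  shows "lam B b s \<in> Soc B"
proof -
  have sc: "s \<in> carrier B"
    using s by (simp add: Soc_def ker_lam_def)
  have "lam B (b \<otimes> s \<otimes> inv b) x = x" if "x \<in> carrier B" for x
    using b sc s that by (simp add: lam_mult) (simp add: Soc_def ker_lam_def)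
  then have "lam B b s \<in> ker_lam B"
    using b sc lam_Soc_eq_conj[OF b s] by (simp add: ker_lam_def)
  moreover have "lam B b s \<oplus> x = x \<oplus> lam B b s" if x: "x \<in> carrier B" for x
  proof -
    define d where "d = lam B (inv b) x"
    have d: "d \<in> carrier B" "lam B b d = x"
      using b x by (simp_all add: d_def)
    have "s \<oplus> d = d \<oplus> s"
      using s d by (simp add: Soc_def group_centre_def)
    then have "lam B b (s \<oplus> d) = lam B b (d \<oplus> s)"
      by simp
    then show ?thesis
      using b sc d by (simp add: lam_add)
  qed
  ultimately show ?thesis
    using b sc by (simp add: Soc_def group_centre_def)
qed

text \<open>On the left, \<open>star B b s\<close> is the difference of \<open>lam B b s\<close> and
  \<open>s\<close>, both in \<open>I\<close>. On the right, \<open>star B s b\<close> vanishes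
  because \<open>s\<close> lies in the kernel of lambda. Normality follows from additive
  centrality.\<close>

lemma brace_ideal_of_Soc_subset:
  assumes I: "subbrace I B" "I \<subseteq> Soc B"
    and lam: "\<And>b s. \<lbrakk>b \<in> carrier B; s \<in> I\<rbrakk> \<Longrightarrow> lam B b s \<in> I"
  shows "brace_ideal I B"
proof -
  have add: "subgroup I (add_monoid B)"
    using I by (simp add: subbrace_def)
  have minus: "x \<oplus> \<ominus> y \<in> I" if "x \<in> I" "y \<in> I" for x y
    using subgroup.m_closed[OF add that(1) subgroup.m_inv_closed[OF add that(2)]]
    by (simp add: a_inv_def)
  have "star_set B (carrier B) I \<subseteq> I"
    unfolding star_set_def
    by (rule group.generate_subgroup_incl[OF add_group _ add])
      (auto simp: star_eq_lam_minus intro: minus lam)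
  moreover have "star_set B I (carrier B) \<subseteq> I"
  proof -
    have "star B s b \<in> I" if "s \<in> I" "b \<in> carrier B" for s b
    proof -
      have "star B s b = \<zero>"
        using that I(2) by (auto simp: star_eq_lam_minus Soc_def ker_lam_def)
      then show ?thesis
        using subgroup.one_closed[OF add] by simp
    qed
    then show ?thesis
      unfolding star_set_def
      by (intro group.generate_subgroup_incl[OF add_group _ add]) auto
  qed
  moreover have "I \<lhd> add_monoid B"
    using I(2) by (intro group.central_subgroup_normal[OF add_group add]) (auto simp: Soc_def)
  ultimately show ?thesis
    using I(1) by (simp add: brace_ideal_def left_ideal_def right_ideal_def)
qed

lemma Soc_brace_ideal: "brace_ideal (Soc B) B"
  by (rule brace_ideal_of_Soc_subset) (simp_all add: Soc_subbrace lam_Soc_closed)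

lemma brace_centre_brace_ideal: "brace_ideal (brace_centre B) B"
proof (rule brace_ideal_of_Soc_subset)
  fix b s assume b: "b \<in> carrier B" and s: "s \<in> brace_centre B"
  have sc: "s \<in> Soc B" "s \<in> carrier B" "b \<otimes> s = s \<otimes> b"
    using b s by (auto simp: brace_centre_def group_centre_def)
  \<comment> \<open>Lambda acts on the socle by conjugation, which is trivial on multiplicatively
    central elements.\<close>
  have "lam B b s = s \<otimes> b \<otimes> inv b"
    unfolding lam_Soc_eq_conj[OF b sc(1)] sc(3) ..
  then have "lam B b s = s"
    using b sc(2) by (simp add: m_assoc)
  then show "lam B b s \<in> brace_centre B"
    using s by simp
next
  show "brace_centre B \<subseteq> Soc B"
    by (simp add: brace_centre_def)
qed (fact brace_centre_subbrace)

end

section \<open>Skew braces that are both the sum and the product of two subbraces\<close>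

locale factorised_skew_brace = skew_brace +
  fixes A C :: "'a set"
  assumes A: "subbrace A B" and C: "subbrace C B"
    and sum: "carrier B = A <+>\<^bsub>B\<^esub> C" and prod: "carrier B = A <#> C"
begin

lemma A_mem: "x \<in> A \<Longrightarrow> x \<in> carrier B" and C_mem: "x \<in> C \<Longrightarrow> x \<in> carrier B"
  using subbrace_subset[OF A] subbrace_subset[OF C] by auto

lemma sumE:
  assumes "x \<in> carrier B"
  obtains a c where "a \<in> A" "c \<in> C" "x = a \<oplus> c"
proof -
  have "x \<in> A <+>\<^bsub>B\<^esub> C"
    using assms sum by simp
  then show thesis
    using that by (auto simp: set_add_def set_mult_def)
qed

lemma prodE:
  assumes "x \<in> carrier B"
  obtains a c where "a \<in> A" "c \<in> C" "x = a \<otimes> c"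
proof -
  have "x \<in> A <#> C"
    using assms prod by simp
  then show thesis
    using that by (auto simp: set_mult_def)
qed

text \<open>Only the splitting of elements of \<open>S\<close> has to be supplied: the other
  inclusion is closure of \<open>S\<close> under addition.\<close>

lemma factorisedI:
  assumes S: "subbrace S B" and AC: "A \<inter> C \<subseteq> S"
    and dec: "\<And>x. x \<in> S \<Longrightarrow> \<exists>a \<in> A \<inter> S. \<exists>c \<in> C \<inter> S. x = a \<oplus> c"
  shows "factorised S A C B"
proof -
  have closed: "a \<oplus> c \<in> S" if "a \<in> S" "c \<in> S" for a c
    using S that subgroup.m_closed[of S "add_monoid B" a c] by (simp add: subbrace_def)
  have "S = (A \<inter> S) <+>\<^bsub>B\<^esub> (C \<inter> S)"
  proof
    show "S \<subseteq> (A \<inter> S) <+>\<^bsub>B\<^esub> (C \<inter> S)"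
      using dec by (auto simp: set_add_def set_mult_def)
    show "(A \<inter> S) <+>\<^bsub>B\<^esub> (C \<inter> S) \<subseteq> S"
      using closed by (auto simp: set_add_def set_mult_def)
  qed
  then show ?thesis
    using A C S AC sum by (simp add: factorised_def)
qed

section \<open>Trivial factors: Fix and the kernel of lambda\<close>

context
  assumes tA: "trivial_skew_brace (B\<lparr>carrier := A\<rparr>)"
    and tC: "trivial_skew_brace (B\<lparr>carrier := C\<rparr>)"
begin

lemma lam_A: "\<lbrakk>x \<in> A; y \<in> A\<rbrakk> \<Longrightarrow> lam B x y = y"
  and lam_C: "\<lbrakk>x \<in> C; y \<in> C\<rbrakk> \<Longrightarrow> lam B x y = y"
  by (rule trivial_subbrace_lam[OF A tA], assumption+) (rule trivial_subbrace_lam[OF C tC])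

text \<open>The acting element is split as a product, since \<open>lam_mult\<close> turns products
  into composites.\<close>

lemma FixI:
  assumes x: "x \<in> carrier B"
    and "\<And>a. a \<in> A \<Longrightarrow> lam B a x = x" "\<And>c. c \<in> C \<Longrightarrow> lam B c x = x"
  shows "x \<in> Fix B"
proof -
  have "lam B b x = x" if "b \<in> carrier B" for b
    using that by (rule prodE) (use assms A_mem C_mem in \<open>simp add: lam_mult\<close>)
  with x show ?thesis
    by (simp add: Fix_def)
qed

text \<open>Here the argument of \<open>lam B x\<close> is split, as a sum, since
  \<open>lam B x\<close> is additive.\<close>

lemma ker_lamI:
  assumes x: "x \<in> carrier B"
    and "\<And>a. a \<in> A \<Longrightarrow> lam B x a = a" "\<And>c. c \<in> C \<Longrightarrow> lam B x c = c"
  shows "x \<in> ker_lam B"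
proof -
  have "lam B x b = b" if "b \<in> carrier B" for b
    using that by (rule sumE) (use assms A_mem C_mem in \<open>simp add: lam_add\<close>)
  with x show ?thesis
    by (simp add: ker_lam_def)
qed

lemma Fix_factorised: "factorised (Fix B) A C B"
proof (rule factorisedI[OF Fix_subbrace])
  show "A \<inter> C \<subseteq> Fix B"
  proof
    fix x assume "x \<in> A \<inter> C"
    then have x: "x \<in> A" "x \<in> C"
      by simp_all
    show "x \<in> Fix B"
      by (rule FixI[OF A_mem[OF x(1)] lam_A[OF _ x(1)] lam_C[OF _ x(2)]])
  qed
next
  fix x assume x: "x \<in> Fix B"
  then have xc: "x \<in> carrier B"
    by (simp add: Fix_def)
  then obtain a c where ac: "a \<in> A" "c \<in> C" "x = a \<oplus> c"
    by (rule sumE)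
  have acc: "a \<in> carrier B" "c \<in> carrier B"
    using A_mem[OF ac(1)] C_mem[OF ac(2)] .
  have lam_x: "lam B b a \<oplus> lam B b c = a \<oplus> c" if "b \<in> carrier B" for b
    using x that acc unfolding ac(3) by (simp add: Fix_def lam_add)
  \<comment> \<open>As \<open>b\<close> fixes \<open>c\<close>, the right summands in
    \<open>lam_x\<close> cancel. For \<open>lam_c\<close> below, \<open>b\<close> in
    \<open>A\<close> fixes \<open>a\<close> and the left summands cancel.\<close>
  have lam_a: "lam B b a = a" if "b \<in> C" for b
    using lam_x[OF C_mem[OF that]] C_mem[OF that] lam_C[OF that ac(2)] acc by simp
  have a: "a \<in> Fix B"
    by (rule FixI[OF acc(1) lam_A[OF _ ac(1)] lam_a])
  have lam_c: "lam B b c = c" if "b \<in> A" for b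
    using lam_x[OF A_mem[OF that]] A_mem[OF that] lam_A[OF that ac(1)] acc by simp
  have c: "c \<in> Fix B"
    by (rule FixI[OF acc(2) lam_c lam_C[OF _ ac(2)]])
  show "\<exists>a \<in> A \<inter> Fix B. \<exists>c \<in> C \<inter> Fix B. x = a \<oplus> c"
    using IntI[OF ac(1) a] IntI[OF ac(2) c] ac(3) by blast
qed

text \<open>One pair gives both the sum and the product: additive centrality will be tested on the
  former, multiplicative centrality on the latter.\<close>

lemma ker_lam_decomp:
  assumes x: "x \<in> ker_lam B"
  obtains a c where "a \<in> A \<inter> ker_lam B" "c \<in> C \<inter> ker_lam B" "x = a \<oplus> c" "x = a \<otimes> c"
proof -
  have "x \<in> carrier B"
    using x by (simp add: ker_lam_def)
  then obtain a c where ac: "a \<in> A" "c \<in> C" "x = a \<otimes> c"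
    by (rule prodE)
  have acc: "a \<in> carrier B" "c \<in> carrier B"
    using A_mem[OF ac(1)] C_mem[OF ac(2)] .
  have lam_x: "lam B a (lam B c y) = y" if "y \<in> carrier B" for y
    using x that acc unfolding ac(3) by (simp add: ker_lam_def lam_mult)
  have lam_a: "lam B a y = y" if "y \<in> C" for y
    using lam_x[OF C_mem[OF that]] lam_C[OF ac(2) that] by simp
  have a: "a \<in> ker_lam B"
    by (rule ker_lamI[OF acc(1) lam_A[OF ac(1)] lam_a])
  \<comment> \<open>With \<open>lam B a\<close> now the identity, \<open>lam_x\<close> reduces to a
    statement on \<open>lam B c\<close> alone.\<close>
  have "lam B c y = y" if "y \<in> carrier B" for y
    using a lam_x[OF that] that acc by (simp add: ker_lam_def)
  then have "c \<in> ker_lam B"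
    using acc by (simp add: ker_lam_def)
  moreover have "x = a \<oplus> c"
    using a acc mult_eq_add_lam[OF acc] unfolding ac(3) by (simp add: ker_lam_def)
  ultimately show thesis
    using that a ac by blast
qed

lemma Int_subset_ker_lam: "A \<inter> C \<subseteq> ker_lam B"
proof
  fix x assume "x \<in> A \<inter> C"
  then have x: "x \<in> A" "x \<in> C"
    by simp_all
  show "x \<in> ker_lam B"
    by (rule ker_lamI[OF A_mem[OF x(1)] lam_A[OF x(1)] lam_C[OF x(2)]])
qed

lemma ker_lam_factorised: "factorised (ker_lam B) A C B"
  by (rule factorisedI[OF ker_lam_subbrace Int_subset_ker_lam]) (metis ker_lam_decomp)

end

section \<open>Abelian factors: the socle and the centre\<close>

context
  assumes abA: "abelian_skew_brace (B\<lparr>carrier := A\<rparr>)"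
    and abC: "abelian_skew_brace (B\<lparr>carrier := C\<rparr>)"
begin

lemma trivial_A: "trivial_skew_brace (B\<lparr>carrier := A\<rparr>)"
  and trivial_C: "trivial_skew_brace (B\<lparr>carrier := C\<rparr>)"
  using abA abC by (auto dest: abelian_skew_brace.axioms)

text \<open>Multiplicative commutativity is inherited from addition, because the two operations
  agree on a trivial subbrace.\<close>

lemma abelian_subbrace_comm_group:
  assumes S: "subbrace S B" and ab: "abelian_skew_brace (B\<lparr>carrier := S\<rparr>)"
  shows "comm_group ((add_monoid B)\<lparr>carrier := S\<rparr>)" "comm_group (B\<lparr>carrier := S\<rparr>)"
proof -
  interpret S: abelian_skew_brace "B\<lparr>carrier := S\<rparr>"
    by (fact ab)
  show add: "comm_group ((add_monoid B)\<lparr>carrier := S\<rparr>)"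
    using S.add_comm_group by simp
  have "x \<oplus> y = y \<oplus> x" if "x \<in> S" "y \<in> S" for x y
    using comm_monoid.m_comm[OF comm_group.axioms(1)[OF add]] that by simp
  moreover have "x \<otimes> y = x \<oplus> y" if "x \<in> S" "y \<in> S" for x y
    using that subsetD[OF subbrace_subset[OF S]] mult_eq_add_lam[of x y]
      trivial_subbrace_lam[OF S S.trivial_skew_brace_axioms that] by simp
  ultimately show "comm_group (B\<lparr>carrier := S\<rparr>)"
    by (intro S.group_comm_groupI) simp
qed

text \<open>The pair from \<open>ker_lam_decomp\<close> is refined twice by
  \<open>group_centre_factor\<close>: in the additive group it enters the socle, and if
  \<open>x\<close> is also multiplicatively central, the multiplicative group places the same pair
  in the centre.\<close>

lemma Soc_factorised: "factorised (Soc B) A C B"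
  and brace_centre_factorised: "factorised (brace_centre B) A C B"
proof -
  have sg: "subgroup A (add_monoid B)" "subgroup C (add_monoid B)" "subgroup A B" "subgroup C B"
    using A C by (auto simp: subbrace_def)
  have sum': "carrier (add_monoid B) = A <#>\<^bsub>add_monoid B\<^esub> C"
    using sum by (simp add: set_add_def)
  note cA = abelian_subbrace_comm_group[OF A abA]
  note cC = abelian_subbrace_comm_group[OF C abC]
  note add_factor = group.group_centre_factor[OF add_group cA(1) sg(1) cC(1) sg(2) sum']
  note mult_factor = group_centre_factor[OF cA(2) sg(3) cC(2) sg(4) prod]
  have Int_Soc: "A \<inter> C \<subseteq> Soc B"
    using group.Int_subset_group_centre[OF add_group cA(1) sg(1) cC(1) sg(2) sum']
      Int_subset_ker_lam[OF trivial_A trivial_C] by (simp add: Soc_def)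
  have decomp: "\<exists>a \<in> A \<inter> Soc B. \<exists>c \<in> C \<inter> Soc B. x = a \<oplus> c \<and> x = a \<otimes> c"
    if x: "x \<in> Soc B" for x
  proof -
    obtain a c where ac: "a \<in> A \<inter> ker_lam B" "c \<in> C \<inter> ker_lam B" "x = a \<oplus> c" "x = a \<otimes> c"
      using x ker_lam_decomp[OF trivial_A trivial_C, of x] by (auto simp: Soc_def)
    then have "a \<in> A \<inter> Soc B" "c \<in> C \<inter> Soc B"
      using x add_factor[of a c] by (auto simp: Soc_def)
    then show ?thesis
      using ac(3,4) by blast
  qed
  show "factorised (Soc B) A C B"
    by (rule factorisedI[OF Soc_subbrace Int_Soc]) (use decomp in blast)
  show "factorised (brace_centre B) A C B"
  proof (rule factorisedI[OF brace_centre_subbrace])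
    show "A \<inter> C \<subseteq> brace_centre B"
      using Int_Soc Int_subset_group_centre[OF cA(2) sg(3) cC(2) sg(4) prod]
      by (simp add: brace_centre_def)
  next
    fix x assume x: "x \<in> brace_centre B"
    then obtain a c where ac: "a \<in> A \<inter> Soc B" "c \<in> C \<inter> Soc B" "x = a \<oplus> c" "x = a \<otimes> c"
      using decomp[of x] by (auto simp: brace_centre_def)
    then have "a \<in> group_centre B" "c \<in> group_centre B"
      using x mult_factor[of a c] by (auto simp: brace_centre_def)
    then show "\<exists>a \<in> A \<inter> brace_centre B. \<exists>c \<in> C \<inter> brace_centre B. x = a \<oplus> c"
      using ac by (auto simp: brace_centre_def)
  qed
qed

end

end

theorem theorem2:
  fixes B :: "('a, 'm) ring_scheme" (structure)
  assumes "skew_brace B"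
    and "carrier B \<noteq> {\<zero>}"
    and "subbrace A1 B" and "subbrace A2 B"
    and "carrier B = A1 <+>\<^bsub>B\<^esub> A2"
    and "carrier B = A1 <#>\<^bsub>B\<^esub> A2"
  shows "(trivial_skew_brace (B\<lparr>carrier := A1\<rparr>) \<and> trivial_skew_brace (B\<lparr>carrier := A2\<rparr>) \<longrightarrow>
            factorised (Fix B) A1 A2 B \<and> factorised (ker_lam B) A1 A2 B)
       \<and> (abelian_skew_brace (B\<lparr>carrier := A1\<rparr>) \<and> abelian_skew_brace (B\<lparr>carrier := A2\<rparr>) \<longrightarrow>
            brace_ideal (Soc B) B \<and> factorised (Soc B) A1 A2 B \<and>
            brace_ideal (brace_centre B) B \<and> factorised (brace_centre B) A1 A2 B)"
proof -
  interpret factorised_skew_brace B A1 A2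
    using assms by (simp add: factorised_skew_brace_def factorised_skew_brace_axioms_def)
  show ?thesis
    by (simp add: Fix_factorised ker_lam_factorised Soc_factorised brace_centre_factorised
        Soc_brace_ideal brace_centre_brace_ideal)
qed

end
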